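(* Let $\mathcal{H}$ be a real reproducing kernel Hilbert space on $\Omega$, let $\psi:\Omega\to\mathbb{R}$ be continuous, and let $K\subseteq\Omega$ be nonempty and compact. Let $\mu$ be the topiary of $K$ with respect to $\psi$ over $\mathcal{H}$, i.e. a distribution on $K$ maximizing $\mathfrak{O}(\mu)=\int\psi\,d\mu-\|\mu\|^2/2$ over all distributions on $K$, and suppose that $\mu\neq 0$ as an element of $\mathcal{H}$. Let $r_K=\int(\psi(t)-\mu(t))\,d\mu(t)$ and define $\beta(x)=\mu(x)/\|\mu\|^2$ for $x\in\Omega$. Then $\beta\in\mathcal{H}$, and for every $x\in K$ $$\psi(x)-r_K\le \beta(x)\left(\int\psi\,d\mu-r_K\right),$$ where, for $x\in K$, equality holds if and only if $x$ belongs to the topiaric index $\mathrm{Topiary}(K)$.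
   Context: $\Omega$ is a Hausdorff topological space. A real reproducing kernel Hilbert space $\mathcal{H}$ on $\Omega$ is a real Hilbert space of functions $\Omega\to\mathbb{R}$ for which each point evaluation is a bounded functional; $k_x\in\mathcal{H}$ denotes the element with $f(x)=\langle f,k_x\rangle$ for all $f\in\mathcal{H}$. A distribution on a compact set $K\subseteq\Omega$ is a regular Borel probability measure $\mu$ on $K$. It is understood that for every such $\mu$ the functional $f\mapsto\int f\,d\mu$ on $\mathcal{H}$ is well defined and bounded; the element of $\mathcal{H}$ representing it, the embedded distribution, is also denoted $\mu$: $\int f\,d\mu=\langle f,\mu\rangle$. Thus $\|\mu\|$ is the norm of the embedded distribution in $\mathcal{H}$, and $\mu(x)=\langle \mu,k_x\rangle$. The aesthetic margin of $\mu$ is $\iota_\mu(x)=\psi(x)-\mu(x)-\int(\psi(t)-\mu(t))\,d\mu(t)$, a function on $\Omega$. With $\mu$ the topiary of $K$, the topiaric index is $\mathrm{Topiary}(K)=\iota_\mu^{-1}(0)$. The number $r_K$ is called the available topiaric rate, and $\beta$ the topiaric beta. *)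

theory Defs
  imports "HOL-Probability.Probability"
begin

text \<open>
  A real Hilbert space of functions is given by a complete real inner product space \<open>'h\<close>
  and the map \<open>\<Phi>\<close> that sends a vector to the function it is; injectivity says that a vector
  is determined by its values. The set of functions is \<open>range \<Phi>\<close>.
\<close>

definition rkhs :: "('h::{real_inner,complete_space} \<Rightarrow> 'a \<Rightarrow> real) \<Rightarrow> bool" where
  "rkhs \<Phi> \<longleftrightarrow> inj \<Phi> \<and> (\<forall>x. bounded_linear (\<lambda>f. \<Phi> f x))"

text \<open>
  The measure lives on \<open>K\<close> itself, with the Borel sets of the subspace topology, so the
  relatively open sets are written \<open>U \<inter> K\<close>. Regularity is inner and outer.
\<close>

definition distribution_on :: "'a::t2_space set \<Rightarrow> 'a measure \<Rightarrow> bool" where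
  "distribution_on K M \<longleftrightarrow>
     prob_space M \<and> sets M = sets (restrict_space borel K) \<and>
     (\<forall>A\<in>sets M. emeasure M A = (SUP C\<in>{C. compact C \<and> C \<subseteq> A}. emeasure M C)) \<and>
     (\<forall>A\<in>sets M. emeasure M A = (INF U\<in>{U. open U \<and> A \<subseteq> U}. emeasure M (U \<inter> K)))"

definition distributions_embed ::
    "('h::{real_inner,complete_space} \<Rightarrow> 'a::t2_space \<Rightarrow> real) \<Rightarrow> 'a set \<Rightarrow> bool" where
  "distributions_embed \<Phi> K \<longleftrightarrow>
     (\<forall>M. distribution_on K M \<longrightarrow>
        (\<forall>f. integrable M (\<Phi> f)) \<and> bounded_linear (\<lambda>f. \<integral>x. \<Phi> f x \<partial>M))"

text \<open>
  If the integral is a bounded functional, the vector below exists and is unique by the Riesz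
  representation theorem.
\<close>

definition embedded ::
    "('h::{real_inner,complete_space} \<Rightarrow> 'a \<Rightarrow> real) \<Rightarrow> 'a measure \<Rightarrow> 'h" where
  "embedded \<Phi> M = (THE g. \<forall>f. (\<integral>x. \<Phi> f x \<partial>M) = inner f g)"

definition objective ::
    "('h::{real_inner,complete_space} \<Rightarrow> 'a \<Rightarrow> real) \<Rightarrow> ('a \<Rightarrow> real) \<Rightarrow> 'a measure \<Rightarrow> real" where
  "objective \<Phi> \<psi> M = (\<integral>x. \<psi> x \<partial>M) - (norm (embedded \<Phi> M))\<^sup>2 / 2"

definition is_topiary ::
    "('h::{real_inner,complete_space} \<Rightarrow> 'a::t2_space \<Rightarrow> real) \<Rightarrow> ('a \<Rightarrow> real) \<Rightarrow>
     'a set \<Rightarrow> 'a measure \<Rightarrow> bool" where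
  "is_topiary \<Phi> \<psi> K M \<longleftrightarrow>
     distribution_on K M \<and> (\<forall>N. distribution_on K N \<longrightarrow> objective \<Phi> \<psi> N \<le> objective \<Phi> \<psi> M)"

definition topiaric_rate ::
    "('h::{real_inner,complete_space} \<Rightarrow> 'a \<Rightarrow> real) \<Rightarrow> ('a \<Rightarrow> real) \<Rightarrow> 'a measure \<Rightarrow> real" where
  "topiaric_rate \<Phi> \<psi> M = (\<integral>t. (\<psi> t - \<Phi> (embedded \<Phi> M) t) \<partial>M)"

definition aesthetic_margin ::
    "('h::{real_inner,complete_space} \<Rightarrow> 'a \<Rightarrow> real) \<Rightarrow> ('a \<Rightarrow> real) \<Rightarrow> 'a measure \<Rightarrow>
     'a \<Rightarrow> real" where
  "aesthetic_margin \<Phi> \<psi> M x =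
     \<psi> x - \<Phi> (embedded \<Phi> M) x - (\<integral>t. (\<psi> t - \<Phi> (embedded \<Phi> M) t) \<partial>M)"

text \<open>The topiaric index of \<open>K\<close> is the set below for \<open>M\<close> a topiary of \<open>K\<close>.\<close>

definition topiaric_index ::
    "('h::{real_inner,complete_space} \<Rightarrow> 'a \<Rightarrow> real) \<Rightarrow> ('a \<Rightarrow> real) \<Rightarrow> 'a measure \<Rightarrow> 'a set" where
  "topiaric_index \<Phi> \<psi> M = aesthetic_margin \<Phi> \<psi> M -` {0}"

definition topiaric_beta ::
    "('h::{real_inner,complete_space} \<Rightarrow> 'a \<Rightarrow> real) \<Rightarrow> 'a measure \<Rightarrow> 'a \<Rightarrow> real" where
  "topiaric_beta \<Phi> M x = \<Phi> (embedded \<Phi> M) x / (norm (embedded \<Phi> M))\<^sup>2"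

end

(*
  Moving a mass t of the topiary to a point x of K gives the distribution (1 - t) mu + t delta_x,
  whose embedding is mu + t (k_x - mu). Optimality of mu makes the one-sided derivative of the
  objective at t = 0 nonpositive, which says psi x - mu(x) <= int psi d mu - ||mu||^2 = r_K.
  Since int psi d mu - r_K = ||mu||^2, the right-hand side of the claim is mu(x).
*)
theory Submission
  imports Defs
begin

section \<open>One-sided first-order arguments and Riesz representation\<close>

text \<open>Let \<open>s\<close> tend to 0 from the right. This extracts the first-order condition
  at an extremum, \<open>a\<close> being the derivative and \<open>s * b\<close> the quadratic
  remainder after division by \<open>s\<close>.\<close>

lemma nonpos_if_le_small_multiples:
  fixes a b :: real
  assumes "\<And>s. 0 < s \<Longrightarrow> s < 1 \<Longrightarrow> a \<le> s * b"
  shows "a \<le> 0"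
proof -
  have "((\<lambda>s. s * b) \<longlongrightarrow> 0 * b) (at_right 0)"
    by (intro tendsto_intros)
  moreover have "eventually (\<lambda>s. a \<le> s * b) (at_right 0)"
    using eventually_at_right_less[of 0] eventually_at_right_real[of 0 1]
    by (auto intro: assms elim: eventually_mono)
  ultimately have "a \<le> 0 * b"
    by (intro tendsto_lowerbound) auto
  then show ?thesis
    by simp
qed

text \<open>The representing vector minimizes \<open>\<parallel>f\<parallel>\<^sup>2 / 2 - L f\<close>; the parallelogram law makes
  minimizing sequences Cauchy.\<close>

lemma riesz_representation:
  fixes L :: "'h::{real_inner,complete_space} \<Rightarrow> real"
  assumes L: "bounded_linear L"
  obtains g where "\<And>f. L f = inner f g"
proof -
  interpret L: bounded_linear L by fact
  define J where "J f = (norm f)\<^sup>2 / 2 - L f" for f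
  define I where "I = Inf (range J)"
  obtain C where C: "\<And>f. norm (L f) \<le> norm f * C"
    using L.bounded by blast
  \<comment> \<open>Completing the square: \<open>norm f * C\<close> is at most half the sum of the
    two squares.\<close>
  have "- (C\<^sup>2 / 2) \<le> J f" for f
  proof -
    have "0 \<le> (norm f - C)\<^sup>2" by simp
    moreover have "L f \<le> norm f * C" using C[of f] by simp
    ultimately show ?thesis
      unfolding J_def power2_diff by (simp add: field_simps)
  qed
  then have bdd: "bdd_below (range J)"
    by (intro bdd_belowI2)
  have I_le: "I \<le> J f" for f
    unfolding I_def by (rule cINF_lower[OF bdd]) simp
  have "\<exists>f. J f < I + inverse (real (Suc n))" for n
    using cInf_lessD[of "range J" "I + inverse (real (Suc n))"] unfolding I_def by auto
  then obtain X where X: "\<And>n. J (X n) < I + inverse (real (Suc n))"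
    by metis
  \<comment> \<open>Parallelogram law; the contributions of \<open>L\<close> cancel by
    linearity.\<close>
  have midpoint: "(norm (f - g))\<^sup>2 = 4 * (J f + J g - 2 * J ((1/2) *\<^sub>R (f + g)))" for f g
    unfolding J_def L.scaleR L.add
    by (simp add: power2_norm_eq_inner inner_simps inner_commute field_simps)
  have near_min: "(norm (f - g))\<^sup>2 \<le> 4 * (a + b)" if "J f < I + a" "J g < I + b" for f g a b
  proof -
    have "J f + J g - 2 * J ((1/2) *\<^sub>R (f + g)) \<le> a + b"
      using that I_le[of "(1/2) *\<^sub>R (f + g)"] by argo
    then show ?thesis
      unfolding midpoint by simp
  qed
  have "Cauchy X"
  proof (rule metric_CauchyI)
    fix e :: real assume "0 < e"
    \<comment> \<open>Two slacks of \<open>e\<^sup>2 / 16\<close> become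
      \<open>e\<^sup>2 / 2\<close> under \<open>near_min\<close>, which is strictly below
      \<open>e\<^sup>2\<close>.\<close>
    then obtain N where N: "inverse (real (Suc N)) < e\<^sup>2 / 16"
      using reals_Archimedean[of "e\<^sup>2 / 16"] by auto
    have J_X: "J (X k) < I + e\<^sup>2 / 16" if "N \<le> k" for k
    proof -
      have "inverse (real (Suc k)) \<le> inverse (real (Suc N))"
        using that by (intro le_imp_inverse_le) auto
      then show ?thesis
        using X[of k] N by argo
    qed
    have "dist (X m) (X n) < e" if "N \<le> m" "N \<le> n" for m n
    proof -
      have "(norm (X m - X n))\<^sup>2 \<le> e\<^sup>2 / 2"
        using near_min[OF J_X[OF that(1)] J_X[OF that(2)]] by simp
      also have "\<dots> < e\<^sup>2"
        using \<open>0 < e\<close> by simp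
      finally show ?thesis
        using \<open>0 < e\<close> by (simp add: dist_norm power2_less_imp_less)
    qed
    then show "\<exists>M. \<forall>m\<ge>M. \<forall>n\<ge>M. dist (X m) (X n) < e"
      by blast
  qed
  then obtain g where g: "X \<longlonglongrightarrow> g"
    using Cauchy_convergent convergentD by blast
  have "(\<lambda>n. J (X n)) \<longlonglongrightarrow> J g"
    unfolding J_def by (intro tendsto_intros L.tendsto g) simp
  moreover have "(\<lambda>n. I + inverse (real (Suc n))) \<longlonglongrightarrow> I"
    by (rule tendsto_eq_intros LIMSEQ_inverse_real_of_nat refl)+ simp
  ultimately have "J g \<le> I"
    by (rule LIMSEQ_le) (use X less_imp_le in blast)
  then have min: "J g \<le> J f" for f
    using I_le[of f] by simp
  \<comment> \<open>Compare the minimizer \<open>g\<close> with \<open>g + s *\<^sub>R f\<close>.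
    Only one inequality results, since \<open>s\<close> is positive; replacing \<open>f\<close> by
    \<open>- f\<close> gives the other.\<close>
  have le: "L f \<le> inner f g" for f
  proof -
    have "L f - inner f g \<le> s * ((norm f)\<^sup>2 / 2)" if "0 < s" "s < 1" for s
    proof -
      have "s * (L f - inner f g) \<le> s * (s * ((norm f)\<^sup>2 / 2))"
        using min[of "g + s *\<^sub>R f"] unfolding J_def L.add L.scaleR
        by (simp add: power2_norm_eq_inner algebra_simps inner_commute)
      then show ?thesis
        using \<open>0 < s\<close> by simp
    qed
    then show ?thesis
      using nonpos_if_le_small_multiples[of "L f - inner f g" "(norm f)\<^sup>2 / 2"] by simp
  qed
  have "L f = inner f g" for f
    using le[of f] le[of "- f"] by (simp add: L.neg)
  then show ?thesis
    using that by blast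
qed

text \<open>Two representing vectors agree when tested against their own difference, so the definite
  description picks out any vector that represents the integral.\<close>

lemma embedded_eqI:
  fixes \<Phi> :: "'h::{real_inner,complete_space} \<Rightarrow> 'a \<Rightarrow> real"
  assumes g: "\<And>f. (\<integral>x. \<Phi> f x \<partial>M) = inner f g"
  shows "embedded \<Phi> M = g"
  unfolding embedded_def
proof (rule the_equality)
  fix h assume "\<forall>f. (\<integral>x. \<Phi> f x \<partial>M) = inner f h"
  then have "inner (h - g) h = inner (h - g) g"
    using g by simp
  then have "inner (h - g) (h - g) = 0"
    by (simp add: inner_diff_right)
  then show "h = g"
    by simp
qed (use g in simp)

lemma inner_embedded:
  fixes \<Phi> :: "'h::{real_inner,complete_space} \<Rightarrow> 'a \<Rightarrow> real"
  assumes "bounded_linear (\<lambda>f. \<integral>x. \<Phi> f x \<partial>M)"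
  shows "(\<integral>x. \<Phi> f x \<partial>M) = inner f (embedded \<Phi> M)"
  using riesz_representation[OF assms] embedded_eqI[where \<Phi> = \<Phi> and M = M] by metis

section \<open>Mixtures with a point mass\<close>

text \<open>The mixture \<open>(1 - t) M + t \<delta>\<^sub>x\<close>, as the law of the variable that equals \<open>x\<close> with
  probability \<open>t\<close> and is drawn from \<open>M\<close> otherwise.\<close>

definition point_mixture :: "real \<Rightarrow> 'a \<Rightarrow> 'a measure \<Rightarrow> 'a measure" where
  "point_mixture t x M =
     distr (measure_pmf (bernoulli_pmf t) \<Otimes>\<^sub>M M) M (\<lambda>(b, y). if b then x else y)"

lemma sets_point_mixture [simp, measurable_cong]: "sets (point_mixture t x M) = sets M"
  by (simp add: point_mixture_def)

lemma measurable_select_point: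
  assumes "x \<in> space M"
  shows "(\<lambda>(b, y). if b then x else y) \<in> measurable (measure_pmf p \<Otimes>\<^sub>M M) M"
  using assms by measurable

lemma prob_space_point_mixture:
  assumes "prob_space M" "x \<in> space M"
  shows "prob_space (point_mixture t x M)"
proof -
  interpret M: prob_space M by fact
  interpret pair_prob_space "measure_pmf (bernoulli_pmf t)" M ..
  show ?thesis
    unfolding point_mixture_def by (intro prob_space_distr measurable_select_point assms)
qed

text \<open>Change of variables, then Fubini: condition on the coin, which selects either the
  constant \<open>f x\<close> or \<open>f\<close> itself.\<close>

lemma integral_point_mixture:
  fixes f :: "'a \<Rightarrow> real"
  assumes M: "prob_space M" and x: "x \<in> space M" and t: "0 \<le> t" "t \<le> 1"
    and f: "integrable M f"
  shows "(\<integral>y. f y \<partial>point_mixture t x M) = t * f x + (1 - t) * (\<integral>y. f y \<partial>M)"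
proof -
  interpret M: prob_space M by fact
  interpret P: pair_prob_space "measure_pmf (bernoulli_pmf t)" M ..
  note [measurable] = measurable_select_point[OF x] borel_measurable_integrable[OF f]
  have eq: "f (if b then x else y) = (if b then f x else f y)" for b y
    by simp
  have int: "integrable (measure_pmf (bernoulli_pmf t) \<Otimes>\<^sub>M M)
      (\<lambda>z. f (case z of (b, y) \<Rightarrow> if b then x else y))"
  \<comment> \<open>The coin takes finitely many values, so only the integrability of the two
    sections is at stake.\<close>
  proof (rule P.Fubini_integrable)
    show "integrable (measure_pmf (bernoulli_pmf t))
      (\<lambda>b. \<integral>y. norm (f (case (b, y) of (b, y) \<Rightarrow> if b then x else y)) \<partial>M)"
      by (rule integrable_measure_pmf_finite) (rule finite)
    show "AE b in measure_pmf (bernoulli_pmf t).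
      integrable M (\<lambda>y. f (case (b, y) of (b, y) \<Rightarrow> if b then x else y))"
    proof (intro always_eventually allI)
      fix b show "integrable M (\<lambda>y. f (case (b, y) of (b, y) \<Rightarrow> if b then x else y))"
        using f by (cases b) auto
    qed
  qed measurable
  have "(\<integral>y. f y \<partial>point_mixture t x M) =
      (\<integral>z. f (case z of (b, y) \<Rightarrow> if b then x else y) \<partial>(measure_pmf (bernoulli_pmf t) \<Otimes>\<^sub>M M))"
    unfolding point_mixture_def by (rule integral_distr) measurable
  also have "\<dots> = (\<integral>b. \<integral>y. (if b then f x else f y) \<partial>M \<partial>measure_pmf (bernoulli_pmf t))"
    using P.integral_fst'[OF int] by (simp add: eq)
  also have "\<dots> = t * f x + (1 - t) * (\<integral>y. f y \<partial>M)"
    using t by (simp add: M.prob_space)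
  finally show ?thesis .
qed

text \<open>The integral formula for the indicator of \<open>A\<close>; both measures are finite, so
  the real identity transfers to \<open>ennreal\<close>.\<close>

lemma emeasure_point_mixture:
  assumes M: "prob_space M" and x: "x \<in> space M" and t: "0 \<le> t" "t \<le> 1" and A: "A \<in> sets M"
  shows "emeasure (point_mixture t x M) A =
    ennreal t * indicator A x + ennreal (1 - t) * emeasure M A"
proof -
  interpret M: prob_space M by fact
  interpret N: prob_space "point_mixture t x M"
    using M x by (rule prob_space_point_mixture)
  have "integrable M (indicat_real A)"
    using A by (intro integrable_real_indicator) (auto simp: less_top[symmetric])
  then have "measure (point_mixture t x M) A = t * indicator A x + (1 - t) * measure M A"
    using integral_point_mixture[OF M x t, of "indicator A"] A sets.sets_into_space[OF A]
    by (simp add: Int_absorb2 N.emeasure_eq_measure sets_eq_imp_space_eq[OF sets_point_mixture])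
  then show ?thesis
    using t unfolding N.emeasure_eq_measure M.emeasure_eq_measure
    by (simp add: ennreal_plus ennreal_mult ennreal_indicator)
qed

section \<open>Regularity of the mixture\<close>

text \<open>A monotone map that is continuous from the right commutes with nonempty infima. It
  carries outer regularity through the affine formula for the mixture, with \<open>c\<close> the
  weight \<open>1 - t\<close>.\<close>

lemma INF_affine_ennreal:
  fixes a c :: ennreal
  assumes "I \<noteq> {}" and c: "c < top"
  shows "a + c * (INF i\<in>I. f i) = (INF i\<in>I. a + c * f i)"
proof -
  have "((\<lambda>y. a + c * y) \<longlongrightarrow> a + c * Inf (f ` I)) (at_right (Inf (f ` I)))"
    using c by (intro tendsto_add tendsto_const ennreal_tendsto_cmult tendsto_ident_at)
  then have "continuous (at_right (Inf (f ` I))) (\<lambda>y. a + c * y)"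
    by (simp add: continuous_within)
  moreover have "mono (\<lambda>y. a + c * y)"
    by (intro monoI add_left_mono mult_left_mono) auto
  ultimately show ?thesis
    using continuous_at_Inf_mono[of "\<lambda>y. a + c * y" "f ` I"] assms(1) by (simp add: image_comp)
qed

lemma space_distribution_on:
  assumes "distribution_on K M"
  shows "space M = K"
  using assms sets_eq_imp_space_eq[of M "restrict_space borel K"]
  by (simp add: distribution_on_def space_restrict_space)

text \<open>Makes the mixture an admissible competitor for the topiary. In both regularity
  identities one inequality is monotonicity; the other takes approximating sets for \<open>M\<close>
  and adjusts them at the single point \<open>x\<close>.\<close>

lemma distribution_on_point_mixture:
  fixes K :: "'a::t2_space set"
  assumes M: "distribution_on K M" and x: "x \<in> K" and t: "0 \<le> t" "t \<le> 1"
  shows "distribution_on K (point_mixture t x M)"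
proof -
  let ?N = "point_mixture t x M"
  have P: "prob_space M" and S: "sets M = sets (restrict_space borel K)"
    and inner: "\<And>A. A \<in> sets M \<Longrightarrow>
      emeasure M A = (SUP C\<in>{C. compact C \<and> C \<subseteq> A}. emeasure M C)"
    and outer: "\<And>A. A \<in> sets M \<Longrightarrow>
      emeasure M A = (INF U\<in>{U. open U \<and> A \<subseteq> U}. emeasure M (U \<inter> K))"
    using M by (auto simp: distribution_on_def)
  have sp: "x \<in> space M" "space M = K"
    using x space_distribution_on[OF M] by auto
  note N = emeasure_point_mixture[OF P sp(1) t]
  have sub: "A \<subseteq> K" if "A \<in> sets M" for A
    using sets.sets_into_space[OF that] sp by simp
  have open_sets: "U \<inter> K \<in> sets M" if "open U" for U
    using that unfolding S sets_restrict_space by (auto simp: Int_commute)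
  \<comment> \<open>In a Hausdorff space compact sets are closed, hence Borel.\<close>
  have compact_sets: "C \<in> sets M" if "compact C" "C \<subseteq> K" for C
    using that unfolding S sets_restrict_space
    by (auto intro!: image_eqI[of _ _ C] borel_closed compact_imp_closed)
  have "emeasure ?N A = (SUP C\<in>{C. compact C \<and> C \<subseteq> A}. emeasure ?N C)" if A: "A \<in> sets M" for A
  proof (rule antisym)
    have "emeasure ?N A =
        (SUP C\<in>{C. compact C \<and> C \<subseteq> A}. ennreal t * indicator A x + ennreal (1 - t) * emeasure M C)"
      unfolding N[OF A] inner[OF A] SUP_mult_left_ennreal
      by (subst ennreal_SUP_add_right) (auto intro: exI[of _ "{}"])
    also have "\<dots> \<le> (SUP C\<in>{C. compact C \<and> C \<subseteq> A}. emeasure ?N C)"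
    proof (rule SUP_mono)
      fix C assume C: "C \<in> {C. compact C \<and> C \<subseteq> A}"
      \<comment> \<open>the atom is captured by adding \<open>x\<close> to \<open>C\<close>\<close>
      define C' where "C' = (if x \<in> A then insert x C else C)"
      have C': "compact C'" "C' \<subseteq> A" "C' \<in> sets M" "C \<subseteq> C'"
        using C sub[OF A] x by (auto simp: C'_def intro!: compact_sets)
      have "indicator A x \<le> (indicator C' x :: ennreal)"
        by (auto simp: C'_def indicator_def)
      then have "ennreal t * indicator A x + ennreal (1 - t) * emeasure M C \<le> emeasure ?N C'"
        unfolding N[OF C'(3)] using C' by (intro add_mono mult_left_mono emeasure_mono) auto
      with C' show "\<exists>C'\<in>{C. compact C \<and> C \<subseteq> A}.
          ennreal t * indicator A x + ennreal (1 - t) * emeasure M C \<le> emeasure ?N C'"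
        by blast
    qed
    finally show "emeasure ?N A \<le> (SUP C\<in>{C. compact C \<and> C \<subseteq> A}. emeasure ?N C)" .
    show "(SUP C\<in>{C. compact C \<and> C \<subseteq> A}. emeasure ?N C) \<le> emeasure ?N A"
      using A by (auto intro!: SUP_least emeasure_mono)
  qed
  moreover have "emeasure ?N A = (INF U\<in>{U. open U \<and> A \<subseteq> U}. emeasure ?N (U \<inter> K))"
    if A: "A \<in> sets M" for A
  proof (rule antisym)
    show "emeasure ?N A \<le> (INF U\<in>{U. open U \<and> A \<subseteq> U}. emeasure ?N (U \<inter> K))"
      using A sub[OF A] by (auto intro!: INF_greatest emeasure_mono open_sets)
    have "(INF U\<in>{U. open U \<and> A \<subseteq> U}. emeasure ?N (U \<inter> K)) \<le>
        (INF U\<in>{U. open U \<and> A \<subseteq> U}.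
          ennreal t * indicator A x + ennreal (1 - t) * emeasure M (U \<inter> K))"
    proof (rule INF_mono)
      fix U assume U: "U \<in> {U. open U \<and> A \<subseteq> U}"
      \<comment> \<open>the atom is avoided by removing \<open>x\<close> from \<open>U\<close>\<close>
      define U' where "U' = (if x \<in> A then U else U - {x})"
      have U': "open U'" "A \<subseteq> U'" "U' \<subseteq> U"
        using U by (auto simp: U'_def intro: open_delete)
      have "indicator (U' \<inter> K) x \<le> (indicator A x :: ennreal)"
        by (auto simp: U'_def indicator_def)
      then have "emeasure ?N (U' \<inter> K) \<le>
          ennreal t * indicator A x + ennreal (1 - t) * emeasure M (U \<inter> K)"
        unfolding N[OF open_sets[OF U'(1)]] using U U'
        by (intro add_mono mult_left_mono emeasure_mono open_sets) auto
      with U' show "\<exists>U'\<in>{U. open U \<and> A \<subseteq> U}. emeasure ?N (U' \<inter> K) \<le>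
          ennreal t * indicator A x + ennreal (1 - t) * emeasure M (U \<inter> K)"
        by blast
    qed
    also have "\<dots> = emeasure ?N A"
      unfolding N[OF A] outer[OF A]
      by (rule INF_affine_ennreal[symmetric]) (auto intro: exI[of _ UNIV])
    finally show "(INF U\<in>{U. open U \<and> A \<subseteq> U}. emeasure ?N (U \<inter> K)) \<le> emeasure ?N A" .
  qed
  ultimately show ?thesis
    using prob_space_point_mixture[OF P sp(1)] S by (simp add: distribution_on_def)
qed

section \<open>First-order optimality of the topiary\<close>

lemma integrable_continuous_distribution_on:
  fixes \<psi> :: "'a::t2_space \<Rightarrow> real"
  assumes M: "distribution_on K M" and K: "compact K" and \<psi>: "continuous_on K \<psi>"
  shows "integrable M \<psi>"
proof -
  interpret prob_space M
    using M by (simp add: distribution_on_def)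
  have "sets M = sets (restrict_space borel K)"
    using M by (simp add: distribution_on_def)
  then have "\<psi> \<in> borel_measurable M"
    using borel_measurable_continuous_on_restrict[OF \<psi>] measurable_cong_sets by blast
  moreover obtain B where "\<And>x. x \<in> K \<Longrightarrow> norm (\<psi> x) \<le> B"
    using compact_imp_bounded[OF compact_continuous_image[OF \<psi> K]] unfolding bounded_iff by auto
  ultimately show ?thesis
    by (intro integrable_const_bound[of _ B])
      (auto simp: space_distribution_on[OF M])
qed

text \<open>Optimality along the segment from \<open>\<mu>\<close> to the point mass at
  \<open>x\<close>. The right-hand side is the topiaric rate, because the embedded vector integrates
  to its own squared norm.\<close>

lemma topiary_margin_le:
  fixes \<Phi> :: "'h::{real_inner,complete_space} \<Rightarrow> 'a::t2_space \<Rightarrow> real"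
  assumes rkhs: "rkhs \<Phi>" and \<psi>: "continuous_on K \<psi>" and K: "compact K"
    and emb: "distributions_embed \<Phi> K" and top: "is_topiary \<Phi> \<psi> K \<mu>" and x: "x \<in> K"
  shows "\<psi> x - \<Phi> (embedded \<Phi> \<mu>) x \<le> (\<integral>t. \<psi> t \<partial>\<mu>) - (norm (embedded \<Phi> \<mu>))\<^sup>2"
proof -
  define m where "m = embedded \<Phi> \<mu>"
  have D: "distribution_on K \<mu>"
    and max: "\<And>N. distribution_on K N \<Longrightarrow> objective \<Phi> \<psi> N \<le> objective \<Phi> \<psi> \<mu>"
    using top by (auto simp: is_topiary_def)
  have P: "prob_space \<mu>"
    using D by (simp add: distribution_on_def)
  have sp: "x \<in> space \<mu>"
    using x space_distribution_on[OF D] by simp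
  have int: "integrable \<mu> (\<Phi> f)" and m: "(\<integral>y. \<Phi> f y \<partial>\<mu>) = inner f m" for f
    using emb D inner_embedded[where \<Phi> = \<Phi> and M = \<mu>] by (auto simp: distributions_embed_def m_def)
  \<comment> \<open>The kernel element at \<open>x\<close>, which is the embedding of the point mass
    there.\<close>
  obtain k where k: "\<And>f. \<Phi> f x = inner f k"
    using rkhs riesz_representation[of "\<lambda>f. \<Phi> f x"] unfolding rkhs_def by metis
  \<comment> \<open>The one-sided derivative at \<open>t = 0\<close> of the objective along the
    mixtures.\<close>
  define a where "a = \<psi> x - \<Phi> m x - ((\<integral>t. \<psi> t \<partial>\<mu>) - (norm m)\<^sup>2)"
  have "a \<le> t * ((norm (k - m))\<^sup>2 / 2)" if t: "0 < t" "t < 1" for t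
  proof -
    let ?N = "point_mixture t x \<mu>"
    have t': "0 \<le> t" "t \<le> 1" using t by auto
    note I = integral_point_mixture[OF P sp t']
    \<comment> \<open>Integration is affine in the measure, hence so is the embedding.\<close>
    have "embedded \<Phi> ?N = m + t *\<^sub>R (k - m)"
      by (rule embedded_eqI) (simp add: I[OF int] m k algebra_simps inner_simps)
    moreover have "(\<integral>y. \<psi> y \<partial>?N) = t * \<psi> x + (1 - t) * (\<integral>y. \<psi> y \<partial>\<mu>)"
      by (rule I[OF integrable_continuous_distribution_on[OF D K \<psi>]])
    ultimately have "t * \<psi> x + (1 - t) * (\<integral>y. \<psi> y \<partial>\<mu>) - (norm (m + t *\<^sub>R (k - m)))\<^sup>2 / 2
        \<le> (\<integral>y. \<psi> y \<partial>\<mu>) - (norm m)\<^sup>2 / 2"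
      using max[OF distribution_on_point_mixture[OF D x t']]
      by (simp add: objective_def m_def)
    moreover have "(norm (m + t *\<^sub>R (k - m)))\<^sup>2 =
        (norm m)\<^sup>2 + 2 * t * (\<Phi> m x - (norm m)\<^sup>2) + t * (t * (norm (k - m))\<^sup>2)"
      unfolding power2_norm_eq_inner k by (simp add: algebra_simps inner_simps inner_commute)
    ultimately have "t * a \<le> t * (t * ((norm (k - m))\<^sup>2 / 2))"
      unfolding a_def by (simp add: algebra_simps)
    then show ?thesis
      using t by simp
  qed
  then have "a \<le> 0"
    by (rule nonpos_if_le_small_multiples)
  then show ?thesis
    by (simp add: a_def m_def)
qed

theorem theorem4p1:
  fixes \<Phi> :: "'h::{real_inner,complete_space} \<Rightarrow> 'a::t2_space \<Rightarrow> real"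
    and \<psi> :: "'a \<Rightarrow> real" and K :: "'a set" and \<mu> :: "'a measure"
  assumes "rkhs \<Phi>"
    and "continuous_on UNIV \<psi>"
    and "K \<noteq> {}" and "compact K"
    and "distributions_embed \<Phi> K"
    and "is_topiary \<Phi> \<psi> K \<mu>"
    and "embedded \<Phi> \<mu> \<noteq> 0"
  shows "topiaric_beta \<Phi> \<mu> \<in> range \<Phi> \<and>
    (\<forall>x\<in>K.
      \<psi> x - topiaric_rate \<Phi> \<psi> \<mu>
        \<le> topiaric_beta \<Phi> \<mu> x * ((\<integral>t. \<psi> t \<partial>\<mu>) - topiaric_rate \<Phi> \<psi> \<mu>) \<and>
      (\<psi> x - topiaric_rate \<Phi> \<psi> \<mu>
        = topiaric_beta \<Phi> \<mu> x * ((\<integral>t. \<psi> t \<partial>\<mu>) - topiaric_rate \<Phi> \<psi> \<mu>)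
        \<longleftrightarrow> x \<in> topiaric_index \<Phi> \<psi> \<mu>))"
proof -
  define m where "m = embedded \<Phi> \<mu>"
  define r where "r = topiaric_rate \<Phi> \<psi> \<mu>"
  have D: "distribution_on K \<mu>"
    using assms(6) by (simp add: is_topiary_def)
  have \<psi>: "continuous_on K \<psi>"
    using assms(2) by (rule continuous_on_subset) simp
  have int: "integrable \<mu> (\<Phi> f)" and m: "(\<integral>y. \<Phi> f y \<partial>\<mu>) = inner f m" for f
    using assms(5) D inner_embedded[where \<Phi> = \<Phi> and M = \<mu>] by (auto simp: distributions_embed_def m_def)
  \<comment> \<open>Representing the integral of \<open>\<Phi> m\<close> against
    \<open>\<mu>\<close> gives \<open>inner m m\<close>.\<close>
  have r: "r = (\<integral>t. \<psi> t \<partial>\<mu>) - (norm m)\<^sup>2"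
    unfolding r_def topiaric_rate_def m_def[symmetric]
    using integrable_continuous_distribution_on[OF D assms(4) \<psi>] int m
    by (simp add: power2_norm_eq_inner)
  \<comment> \<open>Evaluation at \<open>x\<close> is linear, so beta is the function of a rescaled
    \<open>m\<close>.\<close>
  have "\<Phi> (m /\<^sub>R (norm m)\<^sup>2) x = topiaric_beta \<Phi> \<mu> x" for x
  proof -
    interpret bounded_linear "\<lambda>f. \<Phi> f x"
      using assms(1) by (simp add: rkhs_def)
    show ?thesis
      by (simp add: scaleR topiaric_beta_def m_def divide_inverse mult.commute)
  qed
  then have "topiaric_beta \<Phi> \<mu> \<in> range \<Phi>"
    by (metis ext rangeI)
  \<comment> \<open>By \<open>r\<close> the second factor is the squared norm of \<open>m\<close>,
    nonzero by assumption, and cancels the denominator of beta. Equality in the claim then means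
    that the aesthetic margin vanishes at \<open>x\<close>.\<close>
  moreover have "topiaric_beta \<Phi> \<mu> x * ((\<integral>t. \<psi> t \<partial>\<mu>) - r) = \<Phi> m x" for x
    using assms(7) by (simp add: r topiaric_beta_def m_def)
  moreover have "\<psi> x - r \<le> \<Phi> m x" if "x \<in> K" for x
    using topiary_margin_le[OF assms(1) \<psi> assms(4-6) that] by (simp add: r m_def)
  moreover have "x \<in> topiaric_index \<Phi> \<psi> \<mu> \<longleftrightarrow> \<psi> x - r = \<Phi> m x" for x
    by (auto simp: topiaric_index_def aesthetic_margin_def r_def topiaric_rate_def m_def)
  ultimately show ?thesis
    unfolding r_def[symmetric] by simp
qed

end
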